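(* Let $(\mathbf a,\mathbf b,\mathbf c)$ be the maximal forward solution of the system $$\dot{\mathbf a}=\mathbf b\mathbf c,\qquad \dot{\mathbf b}=\mathbf a\mathbf c^{\top},\qquad \dot{\mathbf c}=\mathbf b^{\top}\mathbf a ,$$ with $\mathbf a(t),\mathbf c(t)\in\mathbb R^m$, $\mathbf b(t)\in\mathbb R^{m\times m}$, starting at time $0$ from initial data $(\mathbf a(0),\mathbf b(0),\mathbf c(0))$. Suppose that $\|\mathbf a(0)\|_2\neq\|\mathbf c(0)\|_2$ and that $$\begin{cases}\|\dot{\mathbf a}(0)\|_2^2-\|\dot{\mathbf c}(0)\|_2^2-\|\mathbf c(0)\|_2^2\big(\|\mathbf c(0)\|_2^2-\|\mathbf a(0)\|_2^2\big)\neq0, & \text{if }\|\mathbf a(0)\|_2>\|\mathbf c(0)\|_2,\\[2pt] \|\dot{\mathbf a}(0)\|_2^2-\|\dot{\mathbf c}(0)\|_2^2-\|\mathbf a(0)\|_2^2\big(\|\mathbf c(0)\|_2^2-\|\mathbf a(0)\|_2^2\big)\neq0, & \text{if }\|\mathbf a(0)\|_2<\|\mathbf c(0)\|_2.\end{cases}$$ Let $E(t)=\mathbf a(t)^{\top}\mathbf b(t)\mathbf c(t)$. Then there exists a finite time $T^*>0$ such that the solution exists on $[0,T^* )$ and $\lim_{t\to T^*}E(t)=+\infty$.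
   Context: $m\ge1$ is an integer. $\|\cdot\|_2$ is the Euclidean norm. $\dot{\mathbf a}(0)=\mathbf b(0)\mathbf c(0)$ and $\dot{\mathbf c}(0)=\mathbf b(0)^{\top}\mathbf a(0)$ denote the time derivatives at time $0$ given by the system. $T^*$ is the right endpoint of the maximal interval of existence of the solution. *)

theory Defs
  imports "HOL-Analysis.Analysis"
begin

text \<open>
  The matrix \<open>a c\<^sup>T\<close> has entries \<open>a\<^sub>i c\<^sub>j\<close>. At an endpoint contained in \<open>I\<close> the derivatives are
  one-sided.
\<close>

definition solves_system ::
  "real set \<Rightarrow> (real \<Rightarrow> real^'n) \<Rightarrow> (real \<Rightarrow> real^'n^'n) \<Rightarrow> (real \<Rightarrow> real^'n) \<Rightarrow> bool" where
  "solves_system I a b c \<longleftrightarrow>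
     (\<forall>t\<in>I. (a has_vector_derivative b t *v c t) (at t within I) \<and>
            (b has_vector_derivative (\<chi> i j. a t $ i * c t $ j)) (at t within I) \<and>
            (c has_vector_derivative transpose (b t) *v a t) (at t within I))"

definition forward_interval :: "ereal \<Rightarrow> real set" where
  "forward_interval T = {t. 0 \<le> t \<and> ereal t < T}"

text \<open>
  Functions are total in HOL, so a forward solution is given by the functions together with the
  right endpoint \<open>T\<close> (possibly infinite) of its interval of existence \<open>[0, T)\<close>; the values outside
  this interval are irrelevant. It is maximal if no solution on a longer interval extends it.
\<close>

definition maximal_forward_solution ::
  "ereal \<Rightarrow> (real \<Rightarrow> real^'n) \<Rightarrow> (real \<Rightarrow> real^'n^'n) \<Rightarrow> (real \<Rightarrow> real^'n) \<Rightarrow> bool" where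
  "maximal_forward_solution T a b c \<longleftrightarrow>
     0 < T \<and> solves_system (forward_interval T) a b c \<and>
     \<not> (\<exists>T' a' b' c'. T < T' \<and> solves_system (forward_interval T') a' b' c' \<and>
          (\<forall>t\<in>forward_interval T. a' t = a t \<and> b' t = b t \<and> c' t = c t))"

end

theory Submission
  imports Defs
begin

text \<open>
  With \<open>E = a\<^sup>T b c\<close>, the functions \<open>\<parallel>a\<parallel>\<^sup>2\<close>, \<open>\<parallel>b\<parallel>\<^sup>2\<close> (Frobenius) and \<open>\<parallel>c\<parallel>\<^sup>2\<close> all have
  derivative \<open>2E\<close>, so \<open>k = \<parallel>a\<parallel>\<^sup>2 - \<parallel>c\<parallel>\<^sup>2\<close> is constant, and so is
  \<open>G = \<parallel>bc\<parallel>\<^sup>2 - \<parallel>b\<^sup>Ta\<parallel>\<^sup>2 + k min(\<parallel>a\<parallel>\<^sup>2, \<parallel>c\<parallel>\<^sup>2)\<close>, which the hypothesis makes nonzero. Hence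
  \<open>E' = \<parallel>bc\<parallel>\<^sup>2 + \<parallel>b\<^sup>Ta\<parallel>\<^sup>2 + \<parallel>a\<parallel>\<^sup>2 \<parallel>c\<parallel>\<^sup>2 \<ge> \<bar>G\<bar> > 0\<close>, as \<open>\<bar>k\<bar> \<le> max(\<parallel>a\<parallel>\<^sup>2, \<parallel>c\<parallel>\<^sup>2)\<close>. Were the
  solution global, \<open>E\<close> and \<open>x = \<parallel>a\<parallel>\<^sup>2\<close> would tend to infinity; then \<open>x' = 2E\<close> and \<open>E' \<ge> x\<^sup>2/2\<close>
  force blow-up in finite time. At the finite endpoint the increasing function \<open>E\<close> is unbounded:
  a bound on \<open>E\<close> bounds \<open>a\<close>, \<open>b\<close>, \<open>c\<close>, and a bounded solution extends by Picard's theorem.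
\<close>

subsection \<open>Local existence and continuation\<close>

text \<open>Banach's fixed point theorem for the integral operator \<open>\<Phi>\<close> on bounded
  continuous functions with values in the ball. The conclusion keeps the integral equation instead
  of a derivative, because that form can be glued to an earlier piece of a solution.\<close>

lemma picard_local_existence:
  fixes f :: "'v::banach \<Rightarrow> 'v" and t0 r L :: real
  assumes lip: "L-lipschitz_on (cball u0 r) f" and r: "r > 0"
  obtains h u where "h > 0" "continuous_on {t0..t0 + h} u"
    "\<And>t. t \<in> {t0..t0 + h} \<Longrightarrow> u t \<in> cball u0 r"
    "\<And>t. t \<in> {t0..t0 + h} \<Longrightarrow> u t = u0 + integral {t0..t} (\<lambda>s. f (u s))"
proof -
  have L: "L \<ge> 0" using lip by (rule lipschitz_on_nonneg)
  define M where "M = norm (f u0) + L * r"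
  have M: "M \<ge> 0" using L r by (simp add: M_def)
  have bound: "norm (f v) \<le> M" if "v \<in> cball u0 r" for v
  proof -
    have "norm (f v - f u0) \<le> L * norm (v - u0)"
      using lipschitz_onD[OF lip that, of u0] r by (simp add: dist_norm)
    also have "\<dots> \<le> L * r"
      using that L by (intro mult_left_mono) (simp_all add: dist_norm norm_minus_commute)
    finally show ?thesis
      using norm_triangle_sub[of "f v" "f u0"] by (simp add: M_def)
  qed
  \<comment> \<open>The first bound gives \<open>M * h \<le> r\<close>, so \<open>\<Phi>\<close>
    maps into the ball; the second gives \<open>L * h \<le> 1 / 2\<close>, the contraction factor.
    Adding 1 keeps the denominators positive.\<close>
  define h where "h = min (r / (M + 1)) (1 / (2 * (L + 1)))"
  have h: "h > 0" using r L M by (simp add: h_def)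
  have hM: "M * h \<le> r"
  proof -
    have "M * h \<le> M * (r / (M + 1))" using M by (intro mult_left_mono) (simp_all add: h_def)
    also have "\<dots> \<le> r" using M r by (simp add: field_simps)
    finally show ?thesis .
  qed
  have hL: "L * h \<le> 1 / 2"
  proof -
    have "L * h \<le> L * (1 / (2 * (L + 1)))" using L by (intro mult_left_mono) (simp_all add: h_def)
    also have "\<dots> \<le> 1 / 2" using L by (simp add: field_simps)
    finally show ?thesis .
  qed
  \<comment> \<open>Clamping time to \<open>{t0..t0 + h}\<close> turns functions on that interval
    into functions on the whole line, the domain of the complete space of bounded continuous
    functions. On the interval itself \<open>\<tau>\<close> is the identity.\<close>
  define \<tau> where "\<tau> t = max t0 (min (t0 + h) t)" for t
  have \<tau>: "\<tau> t \<in> {t0..t0 + h}" for t using h by (auto simp: \<tau>_def)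
  define S where "S = PiC (UNIV :: real set) (\<lambda>_. cball u0 r)"
  define \<Phi> where "\<Phi> u = (\<lambda>t. u0 + integral {t0..\<tau> t} (\<lambda>s. f (apply_bcontfun u s)))" for u
  have mem_S: "u \<in> S \<longleftrightarrow> (\<forall>t. apply_bcontfun u t \<in> cball u0 r)" for u
    by (auto simp: S_def mem_PiC_iff)
  have cont: "continuous_on A (\<lambda>s. f (apply_bcontfun u s))" if "u \<in> S" for u and A
  proof (rule continuous_on_compose2[OF lipschitz_on_continuous_on[OF lip]])
    show "(\<lambda>s. apply_bcontfun u s) ` A \<subseteq> cball u0 r"
      using that unfolding mem_S by blast
  qed simp
  have \<Phi>_cball: "\<Phi> u t \<in> cball u0 r" if "u \<in> S" for u t
  proof -
    have "norm (integral {t0..\<tau> t} (\<lambda>s. f (apply_bcontfun u s))) \<le> M * (\<tau> t - t0)"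
      using \<tau>[of t] that by (intro integral_bound cont bound) (auto simp: mem_S)
    also have "\<dots> \<le> M * h" using \<tau>[of t] M by (intro mult_left_mono) auto
    finally show ?thesis using hM by (simp add: \<Phi>_def dist_norm)
  qed
  have \<Phi>_bcontfun: "\<Phi> u \<in> bcontfun" if "u \<in> S" for u
  proof -
    have "continuous_on {t0..t0 + h} (\<lambda>t. integral {t0..t} (\<lambda>s. f (apply_bcontfun u s)))"
      by (intro indefinite_integral_continuous_1 integrable_continuous_real cont that)
    then have "continuous_on UNIV (\<lambda>t. integral {t0..\<tau> t} (\<lambda>s. f (apply_bcontfun u s)))"
    proof (rule continuous_on_compose2)
      show "continuous_on UNIV \<tau>" unfolding \<tau>_def by (intro continuous_intros)
    qed (use \<tau> in blast)
    then have "continuous_on UNIV (\<Phi> u)" unfolding \<Phi>_def by (intro continuous_intros)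
    moreover have "bounded (range (\<Phi> u))"
      using \<Phi>_cball[OF that] by (intro bounded_subset[OF bounded_cball[of u0 r]]) blast
    ultimately show ?thesis by (simp add: bcontfun_def)
  qed
  define F where "F u = Bcontfun (\<Phi> u)" for u
  have F: "apply_bcontfun (F u) = \<Phi> u" if "u \<in> S" for u
    using \<Phi>_bcontfun[OF that] by (simp add: F_def Bcontfun_inverse)
  have "\<exists>!u. u \<in> S \<and> F u = u"
  proof (rule Banach_fix[of S "1/2" F])
    show "complete S"
      unfolding complete_eq_closed S_def by (intro closed_PiC) simp
    have "const_bcontfun u0 \<in> S" using r by (simp add: mem_S const_bcontfun.rep_eq)
    then show "S \<noteq> {}" by blast
    show "F ` S \<subseteq> S" using \<Phi>_cball by (auto simp: F mem_S)
    show "dist (F u) (F v) \<le> 1/2 * dist u v" if "u \<in> S" "v \<in> S" for u v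
    proof (rule dist_bound)
      fix t
      have int: "(\<lambda>s. f (apply_bcontfun w s)) integrable_on {t0..\<tau> t}" if "w \<in> S" for w
        by (intro integrable_continuous_real cont that)
      have "dist (F u t) (F v t)
          = norm (integral {t0..\<tau> t} (\<lambda>s. f (apply_bcontfun u s) - f (apply_bcontfun v s)))"
        using that int by (simp add: F \<Phi>_def dist_norm integral_diff)
      also have "\<dots> \<le> (L * dist u v) * (\<tau> t - t0)"
      proof (rule integral_bound)
        show "norm (f (apply_bcontfun u s) - f (apply_bcontfun v s)) \<le> L * dist u v" for s
        proof -
          have "dist (f (u s)) (f (v s)) \<le> L * dist (u s) (v s)"
            using that by (intro lipschitz_onD[OF lip]) (auto simp: mem_S)
          also have "\<dots> \<le> L * dist u v"
            by (intro mult_left_mono dist_bounded L)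
          finally show ?thesis by (simp add: dist_norm)
        qed
      qed (use \<tau>[of t] in \<open>auto intro!: continuous_intros cont that\<close>)
      also have "\<dots> \<le> (L * dist u v) * h"
        using \<tau>[of t] L by (intro mult_left_mono) auto
      also have "\<dots> = (L * h) * dist u v" by simp
      also have "\<dots> \<le> 1/2 * dist u v"
        using hL by (intro mult_right_mono) auto
      finally show "dist (F u t) (F v t) \<le> 1/2 * dist u v" .
    qed
  qed simp_all
  then obtain u where u: "u \<in> S" "F u = u" by blast
  have u_eq: "apply_bcontfun u t = u0 + integral {t0..t} (\<lambda>s. f (apply_bcontfun u s))"
    if "t \<in> {t0..t0 + h}" for t
  proof -
    have "apply_bcontfun u t = \<Phi> u t" using F[OF u(1)] u(2) by simp
    moreover have "\<tau> t = t" using that by (auto simp: \<tau>_def)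
    ultimately show ?thesis by (simp add: \<Phi>_def)
  qed
  have u_cball: "apply_bcontfun u t \<in> cball u0 r" for t using u(1) by (simp add: mem_S)
  show thesis by (rule that[OF h _ u_cball u_eq]) simp
qed

text \<open>Along a bounded solution the velocity is bounded, so \<open>z\<close> is Lipschitz and
  has a limit at \<open>T\<close>. Picard's theorem restarts from that limit, and the two pieces are
  joined into \<open>w\<close>.\<close>

lemma bounded_solution_extends:
  fixes f :: "'v::banach \<Rightarrow> 'v" and z :: "real \<Rightarrow> 'v"
  assumes T: "T > 0"
    and deriv: "\<And>t. t \<in> {0..<T} \<Longrightarrow> (z has_vector_derivative f (z t)) (at t within {0..<T})"
    and bounded: "\<And>t. t \<in> {0..<T} \<Longrightarrow> norm (z t) \<le> R"
    and lip: "\<And>R. \<exists>L. L-lipschitz_on (cball 0 R) f"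
  obtains h w where "h > 0" "\<And>t. t \<in> {0..<T} \<Longrightarrow> w t = z t"
    "\<And>t. t \<in> {0..<T + h} \<Longrightarrow> (w has_vector_derivative f (w t)) (at t within {0..<T + h})"
proof -
  obtain L where L: "L-lipschitz_on (cball 0 R) f" using lip by blast
  have R: "R \<ge> 0" using bounded[of 0] T norm_ge_zero[of "z 0"] by (simp del: norm_ge_zero)
  define M where "M = norm (f 0) + L * R"
  have L0: "L \<ge> 0" using L by (rule lipschitz_on_nonneg)
  have M: "norm (f v) \<le> M" if "norm v \<le> R" for v
  proof -
    have "norm (f v - f 0) \<le> L * norm v"
      using lipschitz_onD[OF L, of v 0] that R by (simp add: dist_norm)
    also have "\<dots> \<le> L * R" using that L0 by (intro mult_left_mono)
    finally show ?thesis using norm_triangle_sub[of "f v" "f 0"] by (simp add: M_def)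
  qed
  have "M-lipschitz_on {0..<T} z"
  proof (rule bounded_derivative_imp_lipschitz)
    show "(z has_derivative (\<lambda>x. x *\<^sub>R f (z t))) (at t within {0..<T})" if "t \<in> {0..<T}" for t
      using deriv[OF that] by (simp add: has_vector_derivative_def)
    show "onorm (\<lambda>x. x *\<^sub>R f (z t)) \<le> M" if "t \<in> {0..<T}" for t
      using M[OF bounded[OF that]] by (intro onorm_le) (auto simp: mult.commute[of M] intro: mult_left_mono)
    show "0 \<le> M" using L0 R by (simp add: M_def)
  qed simp
  then have "uniformly_continuous_on {0..<T} z"
    by (rule lipschitz_on_uniformly_continuous)
  then obtain g where g: "uniformly_continuous_on (closure {0..<T}) g"
    and gz: "\<And>t. t \<in> {0..<T} \<Longrightarrow> z t = g t"
    by (rule uniformly_continuous_on_extension_on_closure) (rule that)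
  have g_cont: "continuous_on {0..T} g"
    using uniformly_continuous_imp_continuous[OF g] T by simp
  obtain K where "K-lipschitz_on (cball 0 (norm (g T) + 1)) f" using lip by blast
  moreover have "cball (g T) 1 \<subseteq> cball 0 (norm (g T) + 1)"
  proof
    fix v assume "v \<in> cball (g T) 1"
    then show "v \<in> cball 0 (norm (g T) + 1)"
      using norm_triangle_sub[of v "g T"] by (simp add: dist_norm norm_minus_commute)
  qed
  ultimately have "K-lipschitz_on (cball (g T) 1) f" by (rule lipschitz_on_subset)
  then obtain h u where h: "h > 0" and u: "continuous_on {T..T + h} u"
    and u_eq: "\<And>t. t \<in> {T..T + h} \<Longrightarrow> u t = g T + integral {T..t} (\<lambda>s. f (u s))"
    by (rule picard_local_existence[where ?t0.0 = T, OF _ zero_less_one]) (rule that)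
  have uT: "u T = g T" using u_eq[of T] h by simp
  define w where "w t = (if t \<le> T then g t else u t)" for t
  have w_cont: "continuous_on {0..T + h} w"
    unfolding w_def
  proof (rule continuous_on_cases_le)
    show "continuous_on {t \<in> {0..T + h}. t \<le> T} g"
      by (rule continuous_on_subset[OF g_cont]) auto
    show "continuous_on {t \<in> {0..T + h}. T \<le> t} u"
      by (rule continuous_on_subset[OF u]) auto
  qed (use uT in \<open>auto intro: continuous_intros\<close>)
  have f_cont: "continuous_on UNIV f"
    unfolding continuous_on_eq_continuous_at[OF open_UNIV]
  proof
    fix v :: 'v
    obtain L where "L-lipschitz_on (cball 0 (norm v + 1)) f" using lip by blast
    then have "continuous_on (ball 0 (norm v + 1)) f"
      by (rule continuous_on_subset[OF lipschitz_on_continuous_on ball_subset_cball])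
    then show "isCont f v" by (simp add: continuous_on_eq_continuous_at)
  qed
  have fw_cont: "continuous_on {0..T + h} (\<lambda>t. f (w t))"
    by (rule continuous_on_compose2[OF f_cont w_cont]) simp
  have wz: "w t = z t" if "t \<in> {0..<T}" for t using that by (simp add: w_def gz)
  \<comment> \<open>At \<open>T\<close> only continuity of \<open>w\<close> is known so far; the
    fundamental theorem of calculus with derivatives in the interior covers \<open>t = T\<close> as
    well.\<close>
  have w_eq_le: "((\<lambda>s. f (w s)) has_integral (w t - w 0)) {0..t}" if "t \<in> {0..T}" for t
  proof (rule fundamental_theorem_of_calculus_interior)
    show "continuous_on {0..t} w" using that h by (intro continuous_on_subset[OF w_cont]) auto
    fix s assume s: "s \<in> {0<..<t}"
    then have s': "s \<in> {0<..<T}" using that by auto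
    have "(z has_vector_derivative f (z s)) (at s)"
      using has_vector_derivative_within_subset[OF deriv[of s], of "{0<..<T}"] s'
      by (simp add: subset_iff at_within_open[of s "{0<..<T}"])
    then have "(w has_vector_derivative f (z s)) (at s)"
      by (rule has_vector_derivative_transform_within_open[where S = "{0<..<T}"])
        (use s' in \<open>auto simp: wz\<close>)
    then show "(w has_vector_derivative f (w s)) (at s)" using wz[of s] s' by simp
  qed (use that in auto)
  have w_eq: "w t = w 0 + integral {0..t} (\<lambda>s. f (w s))" if t: "t \<in> {0..T + h}" for t
  proof (cases "t \<le> T")
    case True
    then show ?thesis using integral_unique[OF w_eq_le[of t]] t by simp
  next
    case False
    have "integral {T..t} (\<lambda>s. f (w s)) = integral {T..t} (\<lambda>s. f (u s))"
      by (rule integral_cong) (auto simp: w_def uT)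
    moreover have "integral {0..T} (\<lambda>s. f (w s)) + integral {T..t} (\<lambda>s. f (w s))
        = integral {0..t} (\<lambda>s. f (w s))"
      using T False t
      by (intro Henstock_Kurzweil_Integration.integral_combine integrable_continuous_real
          continuous_on_subset[OF fw_cont]) auto
    moreover have "integral {0..T} (\<lambda>s. f (w s)) = g T - w 0"
      using integral_unique[OF w_eq_le[of T]] T by (simp add: w_def)
    moreover have "w t = g T + integral {T..t} (\<lambda>s. f (u s))"
      using u_eq[of t] False t by (simp add: w_def)
    ultimately show ?thesis by (simp add: algebra_simps)
  qed
  \<comment> \<open>Differentiating one integral equation valid on all of \<open>{0..T + h}\<close>
    also settles the junction \<open>T\<close>, where neither piece gives a two-sided
    derivative.\<close>
  have "(w has_vector_derivative f (w t)) (at t within {0..<T + h})" if t: "t \<in> {0..<T + h}" for t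
  proof -
    have t': "t \<in> {0..T + h}" using t by simp
    have "((\<lambda>s. w 0 + integral {0..s} (\<lambda>s. f (w s))) has_vector_derivative 0 + f (w t))
        (at t within {0..T + h})"
      by (intro has_vector_derivative_add has_vector_derivative_const
          integral_has_vector_derivative fw_cont t')
    then have "((\<lambda>s. w 0 + integral {0..s} (\<lambda>s. f (w s))) has_vector_derivative f (w t))
        (at t within {0..T + h})"
      by simp
    from has_vector_derivative_transform[OF t' _ this, of w] w_eq
    have "(w has_vector_derivative f (w t)) (at t within {0..T + h})" by blast
    then show ?thesis by (rule has_vector_derivative_within_subset) auto
  qed
  with h wz show thesis by (rule that)
qed

text \<open>Both terms of the splitting \<open>B x x - B y y = B (x - y) x + B y (x - y)\<close>
  contain the factor \<open>x - y\<close>. The absolute value of \<open>R\<close> keeps the constant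
  nonnegative when the ball is empty.\<close>

lemma bilinear_quadratic_lipschitz:
  assumes "bounded_bilinear B"
  shows "\<exists>L. L-lipschitz_on (cball 0 R) (\<lambda>z. B z z)"
proof -
  interpret bounded_bilinear B by fact
  obtain K where K: "K > 0" "\<And>x y. norm (B x y) \<le> norm x * norm y * K"
    using pos_bounded by blast
  define L where "L = 2 * K * \<bar>R\<bar>"
  have "dist (B x x) (B y y) \<le> L * dist x y" if "x \<in> cball 0 R" "y \<in> cball 0 R" for x y
  proof -
    have "B x x - B y y = B (x - y) x + B y (x - y)"
      by (simp add: diff_left diff_right)
    then have "norm (B x x - B y y) \<le> norm (x - y) * norm x * K + norm y * norm (x - y) * K"
      by (metis K(2) norm_triangle_le add_mono)
    also have "\<dots> = K * norm (x - y) * (norm x + norm y)" by (simp add: algebra_simps)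
    also have "\<dots> \<le> K * norm (x - y) * (2 * \<bar>R\<bar>)"
      using that K(1) by (intro mult_left_mono) auto
    finally show ?thesis by (simp add: dist_norm L_def mult_ac)
  qed
  moreover have "L \<ge> 0" using K(1) by (simp add: L_def)
  ultimately show ?thesis by (auto simp: lipschitz_on_def)
qed

subsection \<open>Finite-time blow-up\<close>

text \<open>Mean value theorem. Derivatives within a larger \<open>S\<close> allow one-sided ones at
  time 0, while the sign is required only on \<open>{s..t}\<close>, so bounds that hold from some
  time on can be used.\<close>

lemma mono_of_derivative_within:
  fixes f f' :: "real \<Rightarrow> real"
  assumes "s \<le> t" and S: "{s..t} \<subseteq> S"
    and "\<And>u. u \<in> S \<Longrightarrow> (f has_real_derivative f' u) (at u within S)"
    and "\<And>u. u \<in> {s..t} \<Longrightarrow> f' u \<ge> 0"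
  shows "f s \<le> f t"
proof -
  have "(f has_derivative (*) (f' u)) (at u within {s..t})" if "s \<le> u" "u \<le> t" for u
    using DERIV_subset[OF assms(3) S, of u] that S
    by (auto simp: has_field_derivative_def)
  from mvt_very_simple[OF assms(1) this] obtain u
    where u: "u \<in> {s..t}" "f t - f s = f' u * (t - s)" by auto
  have "0 \<le> f' u * (t - s)" using assms(1) assms(4)[OF u(1)] by simp
  then show ?thesis using u(2) by linarith
qed

text \<open>Scalar core of the blow-up, applied with \<open>x\<close> = |a|^2, \<open>E\<close> = a
  . bc, \<open>D\<close> = E' and \<open>\<delta>\<close> the bound |G|. Since x'' = 2 D, eventually
  x'' \<ge> x^2 with x' > 0, which cannot persist for all time.\<close>

lemma no_global_solution:
  fixes x E D :: "real \<Rightarrow> real" and \<delta> k :: real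
  assumes x: "\<And>t. t \<ge> 0 \<Longrightarrow> (x has_real_derivative 2 * E t) (at t within {0..})"
    and E: "\<And>t. t \<ge> 0 \<Longrightarrow> (E has_real_derivative D t) (at t within {0..})"
    and \<delta>: "\<delta> > 0" "\<And>t. t \<ge> 0 \<Longrightarrow> D t \<ge> \<delta>"
    and D: "\<And>t. t \<ge> 0 \<Longrightarrow> D t \<ge> x t * (x t - k)"
  shows False
proof -
  have E_lower: "E t \<ge> E 0 + \<delta> * t" if "t \<ge> 0" for t
  proof -
    have "E 0 - \<delta> * 0 \<le> E t - \<delta> * t"
      by (rule mono_of_derivative_within[where S = "{0..}" and f' = "\<lambda>t. D t - \<delta>"])
        (use that \<delta> in \<open>auto intro!: derivative_eq_intros E\<close>)
    then show ?thesis by simp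
  qed
  \<comment> \<open>The time at which the linear lower bound for \<open>E\<close> reaches 1, cut off
    at 0 to stay in the domain.\<close>
  define t1 where "t1 = max 0 ((1 - E 0) / \<delta>)"
  have t1: "t1 \<ge> 0" by (simp add: t1_def)
  have E1: "E t \<ge> 1" if "t \<ge> t1" for t
  proof -
    have "\<delta> * ((1 - E 0) / \<delta>) \<le> \<delta> * t"
      using that \<delta>(1) by (intro mult_left_mono) (auto simp: t1_def)
    then show ?thesis using E_lower[of t] that t1 \<delta>(1) by simp
  qed
  have x_lower: "x t \<ge> x t1 + 2 * (t - t1)" if "t \<ge> t1" for t
  proof -
    have "x t1 - 2 * t1 \<le> x t - 2 * t"
      by (rule mono_of_derivative_within[where S = "{0..}" and f' = "\<lambda>t. 2 * E t - 2"])
        (use that t1 E1 in \<open>auto intro!: derivative_eq_intros x\<close>)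
    then show ?thesis by simp
  qed
  have x_large: "\<exists>t'\<ge>t1. \<forall>t\<ge>t'. x t \<ge> N" for N
  proof -
    define t' where "t' = t1 + \<bar>N - x t1\<bar>"
    have "x t \<ge> N" if "t \<ge> t'" for t
    proof -
      have "t - t1 \<ge> \<bar>N - x t1\<bar>" using that by (simp add: t'_def)
      then have "t \<ge> t1" "t - t1 \<ge> N - x t1" by simp_all
      with x_lower[of t] show ?thesis by simp
    qed
    moreover have "t' \<ge> t1" by (simp add: t'_def)
    ultimately show ?thesis by blast
  qed
  \<comment> \<open>Beyond this threshold \<open>x\<close> is positive and
    \<open>k \<le> x / 2\<close>, hence \<open>x * (x - k) \<ge> x^2 / 2\<close>.\<close>
  obtain t2 where t2: "t2 \<ge> t1" and xt2: "\<And>t. t \<ge> t2 \<Longrightarrow> x t \<ge> 2 * \<bar>k\<bar> + 1"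
    using x_large by meson
  have D_lower: "D t \<ge> (x t)\<^sup>2 / 2" if "t \<ge> t2" for t
  proof -
    have "x t * (x t - k) \<ge> x t * (x t / 2)"
      using xt2[OF that] by (intro mult_left_mono) (auto simp: abs_if split: if_splits)
    then show ?thesis using D[of t] t1 t2 that by (simp add: power2_eq_square)
  qed
  \<comment> \<open>Integrating \<open>E E' \<ge> x\<^sup>2 x'/4\<close> gives \<open>E \<ge> x\<^bsup>3/2\<^esup>/4\<close> eventually, so \<open>x\<^bsup>-1/2\<^esup>\<close> decreases at a
    fixed rate and would become negative.\<close>
  define V where "V t = (E t)\<^sup>2 / 2 - (x t)^3 / 12" for t
  have V: "V t2 \<le> V t" if "t \<ge> t2" for t
  proof (rule mono_of_derivative_within[where s = t2 and t = t and f = V and S = "{0..}"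
        and f' = "\<lambda>t. E t * (D t - (x t)\<^sup>2 / 2)"])
    show "(V has_real_derivative E u * (D u - (x u)\<^sup>2 / 2)) (at u within {0..})" if "u \<in> {0..}" for u
      unfolding V_def using that
      by (auto intro!: derivative_eq_intros x E simp: field_simps power2_eq_square)
    show "E u * (D u - (x u)\<^sup>2 / 2) \<ge> 0" if "u \<in> {t2..t}" for u
      using that D_lower[of u] E1[of u] t2 by (intro mult_nonneg_nonneg) auto
  qed (use that t1 t2 in auto)
  \<comment> \<open>As \<open>x \<ge> 1\<close>, here
    \<open>x^3 \<ge> x \<ge> 24 * \<bar>V t2\<bar>\<close>, so the integration constant costs at
    most half of \<open>x^3 / 12\<close>. This leaves \<open>E^2 \<ge> x^3 / 12\<close>, weakened
    below to \<open>x^3 / 16\<close>, a perfect square.\<close>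
  obtain t3' where t3': "t3' \<ge> t1" "\<And>t. t \<ge> t3' \<Longrightarrow> x t \<ge> 24 * \<bar>V t2\<bar> + 1"
    using x_large by meson
  define t3 where "t3 = max t2 t3'"
  have t3: "t3 \<ge> 0" "t3 \<ge> t1" "t3 \<ge> t2" "t3 \<ge> t3'" using t1 t2 by (auto simp: t3_def)
  have x1: "x t \<ge> 1" if "t \<ge> t3" for t using t3'(2)[of t] that t3 by auto
  have E_large: "E t \<ge> x t * sqrt (x t) / 4" if t: "t \<ge> t3" for t
  proof (rule power2_le_imp_le)
    have "x t ^ 1 \<le> x t ^ 3" using x1[OF t] by (intro power_increasing) auto
    then have "\<bar>V t2\<bar> \<le> x t ^ 3 / 24" using t3'(2)[of t] t t3 by simp
    moreover have "V t2 \<le> (E t)\<^sup>2 / 2 - x t ^ 3 / 12"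
      using V[of t] t t3 unfolding V_def[of t] by simp
    moreover have "- \<bar>V t2\<bar> \<le> V t2" by simp
    ultimately have "(E t)\<^sup>2 \<ge> x t ^ 3 / 12" by linarith
    moreover have "(x t * sqrt (x t) / 4)\<^sup>2 = x t ^ 3 / 16"
      using x1[OF t] by (simp add: power_divide power_mult_distrib power2_eq_square power3_eq_cube)
    moreover have "x t ^ 3 / 16 \<le> x t ^ 3 / 12" using x1[OF t] by simp
    ultimately show "(x t * sqrt (x t) / 4)\<^sup>2 \<le> (E t)\<^sup>2" by linarith
  qed (use E1[of t] t t3 in auto)
  have w: "1 / sqrt (x t) \<le> 1 / sqrt (x t3) - (t - t3) / 4" if t: "t \<ge> t3" for t
  proof -
    \<comment> \<open>Monotonicity is taken within \<open>{t3..}\<close>, where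
      \<open>x \<ge> 1\<close> makes the inverse square root differentiable.\<close>
    have "- (1 / sqrt (x t3)) - t3 / 4 \<le> - (1 / sqrt (x t)) - t / 4"
    proof (rule mono_of_derivative_within[where s = t3 and t = t and S = "{t3..}"
          and f = "\<lambda>t. - (1 / sqrt (x t)) - t / 4" and f' = "\<lambda>t. E t / (x t * sqrt (x t)) - 1 / 4"])
      fix u assume u: "u \<in> {t3..}"
      have xu: "x u > 0" using x1[of u] u by auto
      have "(x has_real_derivative 2 * E u) (at u within {t3..})"
        using u t3 by (intro DERIV_subset[OF x[of u]]) auto
      then show "((\<lambda>t. - (1 / sqrt (x t)) - t / 4) has_real_derivative
          E u / (x u * sqrt (x u)) - 1 / 4) (at u within {t3..})"
        using xu by (auto intro!: derivative_eq_intros simp: field_simps)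
    next
      fix u assume "u \<in> {t3..t}"
      then show "E u / (x u * sqrt (x u)) - 1 / 4 \<ge> 0"
        using E_large[of u] x1[of u] by (simp add: field_simps)
    qed (use t in auto)
    then show ?thesis by (simp add: field_simps)
  qed
  \<comment> \<open>The time at which the upper bound for \<open>1 / sqrt (x t)\<close> reaches
    exactly zero.\<close>
  define t4 where "t4 = t3 + 4 / sqrt (x t3)"
  have "t4 \<ge> t3" using x1[of t3] by (simp add: t4_def)
  moreover have "1 / sqrt (x t4) > 0" using x1[OF calculation] by simp
  ultimately show False using w[of t4] by (simp add: t4_def)
qed

subsection \<open>Conserved quantities\<close>

lemma bounded_bilinear_matrix_vector_mult:
  "bounded_bilinear ((*v) :: real^'n^'m \<Rightarrow> real^'n \<Rightarrow> real^'m)"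
  unfolding bilinear_conv_bounded_bilinear[symmetric] bilinear_def
  by (auto intro!: linearI simp: matrix_vector_right_distrib matrix_vector_mult_add_rdistrib
      scaleR_matrix_vector_assoc matrix_scaleR_vector_ac)

lemma bounded_linear_transpose: "bounded_linear (transpose :: real^'n^'m \<Rightarrow> real^'m^'n)"
  unfolding linear_conv_bounded_linear[symmetric]
  by (intro linearI) (simp_all add: transpose_def vec_eq_iff)

lemma outer_mult_vec: "(\<chi> i j. u $ i * v $ j) *v w = (v \<bullet> w) *\<^sub>R (u :: real^'n)"
  by (simp add: vec_eq_iff matrix_vector_mult_def inner_vec_def sum_distrib_left mult_ac)

lemma transpose_outer_mult_vec:
  "transpose (\<chi> i j. u $ i * v $ j) *v w = ((u :: real^'n) \<bullet> w) *\<^sub>R v"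
  by (simp add: transpose_def vec_eq_iff matrix_vector_mult_def inner_vec_def sum_distrib_left mult_ac)

lemma inner_matrix_vector_transpose:
  "u \<bullet> (A *v v) = (transpose A *v u) \<bullet> (v :: real^'n)"
  by (simp add: dot_lmul_matrix[symmetric])

text \<open>The inner product of matrices is the Frobenius one, so this makes the derivative of
  |b|^2 equal to 2 E, as for |a|^2 and |c|^2.\<close>

lemma inner_outer: "A \<bullet> (\<chi> i j. u $ i * v $ j) = u \<bullet> (A *v (v :: real^'n))"
  by (simp add: inner_vec_def matrix_vector_mult_def sum_distrib_left mult_ac)

context
  fixes S :: "real set" and a c :: "real \<Rightarrow> real^'n" and b :: "real \<Rightarrow> real^'n^'n"
  assumes sol: "solves_system S a b c"
begin

lemma a_deriv: "t \<in> S \<Longrightarrow> (a has_vector_derivative b t *v c t) (at t within S)"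
  and b_deriv: "t \<in> S \<Longrightarrow> (b has_vector_derivative (\<chi> i j. a t $ i * c t $ j)) (at t within S)"
  and c_deriv: "t \<in> S \<Longrightarrow> (c has_vector_derivative transpose (b t) *v a t) (at t within S)"
  using sol by (auto simp: solves_system_def)

lemma bc_deriv:
  assumes "t \<in> S"
  shows "((\<lambda>t. b t *v c t) has_vector_derivative
    b t *v (transpose (b t) *v a t) + (c t \<bullet> c t) *\<^sub>R a t) (at t within S)"
  using bounded_bilinear.has_vector_derivative
    [OF bounded_bilinear_matrix_vector_mult b_deriv c_deriv, OF assms assms]
  by (simp add: outer_mult_vec)

lemma bTa_deriv:
  assumes "t \<in> S"
  shows "((\<lambda>t. transpose (b t) *v a t) has_vector_derivative
    transpose (b t) *v (b t *v c t) + (a t \<bullet> a t) *\<^sub>R c t) (at t within S)"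
  using bounded_bilinear.has_vector_derivative
    [OF bounded_bilinear_matrix_vector_mult
      bounded_linear.has_vector_derivative[OF bounded_linear_transpose b_deriv] a_deriv,
      OF assms assms]
  by (simp add: transpose_outer_mult_vec del: transpose_matrix_vector)

lemma inner_self_deriv:
  assumes "(f has_vector_derivative f') (at t within S)"
  shows "((\<lambda>t. f t \<bullet> f t) has_real_derivative 2 * (f t \<bullet> f')) (at t within S)"
  using bounded_bilinear.has_vector_derivative[OF bounded_bilinear_inner assms assms]
  by (simp add: has_real_derivative_iff_has_vector_derivative inner_commute)

lemma norm_a_deriv: "t \<in> S \<Longrightarrow> ((\<lambda>t. a t \<bullet> a t) has_real_derivative 2 * (a t \<bullet> (b t *v c t))) (at t within S)"
  by (rule inner_self_deriv[OF a_deriv])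

lemma norm_c_deriv: "t \<in> S \<Longrightarrow> ((\<lambda>t. c t \<bullet> c t) has_real_derivative 2 * (a t \<bullet> (b t *v c t))) (at t within S)"
  using inner_self_deriv[OF c_deriv] by (simp add: inner_matrix_vector_transpose inner_commute)

lemma norm_b_deriv: "t \<in> S \<Longrightarrow> ((\<lambda>t. b t \<bullet> b t) has_real_derivative 2 * (a t \<bullet> (b t *v c t))) (at t within S)"
  using inner_self_deriv[OF b_deriv] by (simp add: inner_outer)

text \<open>The cross terms bc . b(b^T a) and b^T a . b^T(bc) are equal and cancel in the
  difference; only the terms from differentiating the matrix \<open>b\<close> survive.\<close>

lemma speed_deriv:
  assumes "t \<in> S"
  shows "((\<lambda>t. (b t *v c t) \<bullet> (b t *v c t) - (transpose (b t) *v a t) \<bullet> (transpose (b t) *v a t))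
    has_real_derivative 2 * (c t \<bullet> c t - a t \<bullet> a t) * (a t \<bullet> (b t *v c t))) (at t within S)"
  by (rule DERIV_cong[OF DERIV_diff[OF inner_self_deriv[OF bc_deriv] inner_self_deriv[OF bTa_deriv]]])
    (use assms in \<open>simp_all add: inner_add_right inner_matrix_vector_transpose[of "b t *v c t"]
      inner_matrix_vector_transpose[of "transpose (b t) *v a t"] inner_commute
      inner_matrix_vector_transpose[of "a t"] algebra_simps\<close>)

text \<open>The product rule yields a' . bc = |bc|^2, a . b(b^T a) = |b^T a|^2 and a . |c|^2 a =
  |a|^2 |c|^2.\<close>

lemma E_deriv:
  assumes "t \<in> S"
  shows "((\<lambda>t. a t \<bullet> (b t *v c t)) has_real_derivative (b t *v c t) \<bullet> (b t *v c t)
    + (transpose (b t) *v a t) \<bullet> (transpose (b t) *v a t) + (a t \<bullet> a t) * (c t \<bullet> c t)) (at t within S)"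
  using bounded_bilinear.has_vector_derivative[OF bounded_bilinear_inner a_deriv bc_deriv, OF assms assms]
  by (simp add: has_real_derivative_iff_has_vector_derivative inner_add_right
      inner_matrix_vector_transpose[of "a t"] inner_commute algebra_simps)

end

lemma const_of_zero_derivative_within:
  fixes f :: "real \<Rightarrow> real"
  assumes "convex S" "\<And>t. t \<in> S \<Longrightarrow> (f has_real_derivative 0) (at t within S)" "s \<in> S" "t \<in> S"
  shows "f t = f s"
  using has_field_derivative_zero_constant[OF assms(1,2)] assms(3,4) by metis

lemma norm_difference_const:
  assumes "solves_system S a b c" "convex S" "s \<in> S" "t \<in> S"
  shows "a t \<bullet> a t - c t \<bullet> c t = a s \<bullet> a s - c s \<bullet> c s"
    and "b t \<bullet> b t - a t \<bullet> a t = b s \<bullet> b s - a s \<bullet> a s"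
proof -
  show "a t \<bullet> a t - c t \<bullet> c t = a s \<bullet> a s - c s \<bullet> c s"
    by (rule const_of_zero_derivative_within[where f = "\<lambda>t. a t \<bullet> a t - c t \<bullet> c t", OF assms(2) _ assms(3,4)])
      (rule DERIV_cong[OF DERIV_diff[OF norm_a_deriv norm_c_deriv]], use assms(1) in auto)
  show "b t \<bullet> b t - a t \<bullet> a t = b s \<bullet> b s - a s \<bullet> a s"
    by (rule const_of_zero_derivative_within[where f = "\<lambda>t. b t \<bullet> b t - a t \<bullet> a t", OF assms(2) _ assms(3,4)])
      (rule DERIV_cong[OF DERIV_diff[OF norm_b_deriv norm_a_deriv]], use assms(1) in auto)
qed

text \<open>With k = |a|^2 - |c|^2 constant, \<open>speed_deriv\<close> reads -2 k E, which is
  compensated by the derivative 2 k E of k |c|^2.\<close>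

lemma speed_difference_const:
  assumes sol: "solves_system S a b c" and S: "convex S" "s \<in> S" "t \<in> S"
  defines "G \<equiv> \<lambda>t. (b t *v c t) \<bullet> (b t *v c t)
    - (transpose (b t) *v a t) \<bullet> (transpose (b t) *v a t)
    + (a s \<bullet> a s - c s \<bullet> c s) * (c t \<bullet> c t)"
  shows "G t = G s"
proof (rule const_of_zero_derivative_within[OF S(1) _ S(2,3)])
  fix u assume u: "u \<in> S"
  have c_u: "c u \<bullet> c u = a u \<bullet> a u - (a s \<bullet> a s - c s \<bullet> c s)"
    using norm_difference_const(1)[OF sol S(1,2) u] by simp
  show "(G has_real_derivative 0) (at u within S)"
    unfolding G_def
    by (rule DERIV_cong[OF DERIV_add[OF speed_deriv[OF sol u] DERIV_cmult[OF norm_c_deriv[OF sol u]]]])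
      (simp add: c_u algebra_simps)
qed

text \<open>The sign of \<open>k\<close> is fixed, so the same one of |a|^2, |c|^2 is the smaller at
  all times and \<open>G = p - q + k * min x y\<close> holds at time \<open>t\<close> too. Then
  \<bar>k\<bar> \<le> max x y bounds the last term by \<open>x * y\<close>.\<close>

lemma E_deriv_lower_bound:
  assumes sol: "solves_system S a b c" and S: "convex S" "0 \<in> S" "t \<in> S"
  defines "G \<equiv> (b 0 *v c 0) \<bullet> (b 0 *v c 0)
    - (transpose (b 0) *v a 0) \<bullet> (transpose (b 0) *v a 0)
    + (a 0 \<bullet> a 0 - c 0 \<bullet> c 0) * min (a 0 \<bullet> a 0) (c 0 \<bullet> c 0)"
  shows "\<bar>G\<bar> \<le> (b t *v c t) \<bullet> (b t *v c t)
    + (transpose (b t) *v a t) \<bullet> (transpose (b t) *v a t) + (a t \<bullet> a t) * (c t \<bullet> c t)"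
proof -
  define k where "k = a 0 \<bullet> a 0 - c 0 \<bullet> c 0"
  define x y p q where "x = a t \<bullet> a t" and "y = c t \<bullet> c t"
    and "p = (b t *v c t) \<bullet> (b t *v c t)"
    and "q = (transpose (b t) *v a t) \<bullet> (transpose (b t) *v a t)"
  have nonneg: "x \<ge> 0" "y \<ge> 0" "p \<ge> 0" "q \<ge> 0"
    by (simp_all add: x_def y_def p_def q_def del: transpose_matrix_vector)
  have k: "x = y + k"
    using norm_difference_const(1)[OF sol S] by (simp add: k_def x_def y_def)
  have Gy: "(b 0 *v c 0) \<bullet> (b 0 *v c 0) - (transpose (b 0) *v a 0) \<bullet> (transpose (b 0) *v a 0)
      = p - q + k * (y - c 0 \<bullet> c 0)"
    using speed_difference_const[OF sol S]
    unfolding p_def q_def y_def k_def by (simp add: algebra_simps del: transpose_matrix_vector)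
  show ?thesis
  proof (cases "k \<ge> 0")
    case True
    then have "G = p - q + k * y"
      unfolding G_def Gy by (simp add: k_def algebra_simps)
    moreover have "0 \<le> k * y" "k * y \<le> x * y"
      using True nonneg k by (auto intro: mult_right_mono)
    ultimately show ?thesis
      using nonneg unfolding p_def[symmetric] q_def[symmetric] x_def[symmetric] y_def[symmetric]
      by linarith
  next
    case False
    \<comment> \<open>Replacing |c|^2 by |a|^2 in the conserved quantity adds the constant
      \<open>k * k\<close>, since \<open>x = y + k\<close>.\<close>
    then have "G = p - q + k * x"
      unfolding G_def Gy k by (simp add: k_def algebra_simps)
    moreover have "k * x \<le> 0" using False nonneg by (simp add: mult_nonpos_nonneg)
    moreover have "- k * x \<le> y * x" using nonneg k by (intro mult_right_mono) auto
    ultimately show ?thesis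
      using nonneg unfolding p_def[symmetric] q_def[symmetric] x_def[symmetric] y_def[symmetric]
      by (simp add: mult.commute[of y])
  qed
qed

section \<open>Continuation of bounded solutions of the system\<close>

text \<open>The right-hand side of the system, polarised: on the diagonal \<open>p = q\<close> it is
  the vector field. Bilinearity supplies the Lipschitz bounds on balls needed for
  continuation.\<close>

definition system_form ::
  "(real^'n) \<times> (real^'n^'n) \<times> (real^'n) \<Rightarrow> (real^'n) \<times> (real^'n^'n) \<times> (real^'n) \<Rightarrow>
    (real^'n) \<times> (real^'n^'n) \<times> (real^'n)" where
  "system_form p q = (fst (snd p) *v snd (snd q), (\<chi> i j. fst p $ i * snd (snd q) $ j),
    transpose (fst (snd p)) *v fst q)"

lemma bounded_bilinear_system_form:
  "bounded_bilinear (system_form :: (real^'n) \<times> (real^'n^'n) \<times> (real^'n) \<Rightarrow> _)"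
proof -
  interpret mult: bounded_bilinear "(*v) :: real^'n^'n \<Rightarrow> real^'n \<Rightarrow> real^'n"
    by (rule bounded_bilinear_matrix_vector_mult)
  interpret transpose: bounded_linear "transpose :: real^'n^'n \<Rightarrow> real^'n^'n"
    by (rule bounded_linear_transpose)
  have "bilinear (system_form :: (real^'n) \<times> (real^'n^'n) \<times> (real^'n) \<Rightarrow> _)"
    unfolding bilinear_def
    by (intro conjI allI linearI)
      (simp_all add: system_form_def prod_eq_iff mult.add_left mult.add_right mult.scaleR_left
        mult.scaleR_right transpose.add transpose.scaleR vec_eq_iff distrib_left distrib_right
        del: transpose_matrix_vector)
  then show ?thesis by (simp add: bilinear_conv_bounded_bilinear)
qed

lemma solves_system_iff:
  "solves_system S a b c \<longleftrightarrow>
    (\<forall>t\<in>S. ((\<lambda>t. (a t, b t, c t)) has_vector_derivative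
      system_form (a t, b t, c t) (a t, b t, c t)) (at t within S))" (is "?L \<longleftrightarrow> ?R")
proof
  show "?L \<Longrightarrow> ?R"
    by (auto simp: solves_system_def system_form_def simp del: transpose_matrix_vector
        intro!: has_vector_derivative_Pair)
  assume R: ?R
  show ?L
    unfolding solves_system_def
  proof (intro ballI conjI)
    fix t assume "t \<in> S"
    with R have *: "((\<lambda>t. (a t, b t, c t)) has_vector_derivative
      system_form (a t, b t, c t) (a t, b t, c t)) (at t within S)" by blast
    note f = bounded_linear.has_vector_derivative[OF bounded_linear_fst]
    note s = bounded_linear.has_vector_derivative[OF bounded_linear_snd]
    show "(a has_vector_derivative b t *v c t) (at t within S)"
      using f[OF *] by (simp add: system_form_def)
    show "(b has_vector_derivative (\<chi> i j. a t $ i * c t $ j)) (at t within S)"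
      using f[OF s[OF *]] by (simp add: system_form_def)
    show "(c has_vector_derivative transpose (b t) *v a t) (at t within S)"
      using s[OF s[OF *]] by (simp add: system_form_def del: transpose_matrix_vector)
  qed
qed

text \<open>A bounded solution on a finite interval would continue past \<open>T\<close>, against
  maximality.\<close>

lemma maximal_imp_unbounded:
  fixes a c :: "real \<Rightarrow> real^'n"
  assumes max: "maximal_forward_solution (ereal T) a b c"
    and bounded: "\<And>t. t \<in> {0..<T} \<Longrightarrow> norm (a t, b t, c t) \<le> R"
  shows False
proof -
  have interval: "forward_interval (ereal T') = {0..<T'}" for T'
    by (auto simp: forward_interval_def)
  have T: "T > 0" and sol: "solves_system {0..<T} a b c"
    using max by (auto simp: maximal_forward_solution_def interval)
  obtain h w where h: "h > 0" and eq: "\<And>t. t \<in> {0..<T} \<Longrightarrow> w t = (a t, b t, c t)"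
    and w: "\<And>t. t \<in> {0..<T + h} \<Longrightarrow>
      (w has_vector_derivative system_form (w t) (w t)) (at t within {0..<T + h})"
    using bounded_solution_extends[OF T, of "\<lambda>t. (a t, b t, c t)" "\<lambda>p. system_form p p" R,
        OF _ bounded bilinear_quadratic_lipschitz[OF bounded_bilinear_system_form]]
      sol[unfolded solves_system_iff] by blast
  define a' b' c' where "a' t = fst (w t)" and "b' t = fst (snd (w t))" and "c' t = snd (snd (w t))" for t
  have "solves_system {0..<T + h} a' b' c'"
    unfolding solves_system_iff a'_def b'_def c'_def using w by simp
  moreover have "\<forall>t\<in>{0..<T}. a' t = a t \<and> b' t = b t \<and> c' t = c t"
    by (simp add: a'_def b'_def c'_def eq)
  moreover have "ereal T < ereal (T + h)" using h by simp
  ultimately show False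
    using max unfolding maximal_forward_solution_def interval[symmetric] by blast
qed

section \<open>Finiteness of the endpoint and divergence of \<open>E\<close>\<close>

theorem theorem1:
  fixes a c :: "real \<Rightarrow> real^'n" and b :: "real \<Rightarrow> real^'n^'n" and T :: ereal
  assumes "maximal_forward_solution T a b c"
    and "norm (a 0) \<noteq> norm (c 0)"
    and "norm (a 0) > norm (c 0) \<Longrightarrow>
           (norm (b 0 *v c 0))\<^sup>2 - (norm (transpose (b 0) *v a 0))\<^sup>2
             - (norm (c 0))\<^sup>2 * ((norm (c 0))\<^sup>2 - (norm (a 0))\<^sup>2) \<noteq> 0"
    and "norm (a 0) < norm (c 0) \<Longrightarrow>
           (norm (b 0 *v c 0))\<^sup>2 - (norm (transpose (b 0) *v a 0))\<^sup>2
             - (norm (a 0))\<^sup>2 * ((norm (c 0))\<^sup>2 - (norm (a 0))\<^sup>2) \<noteq> 0"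
  shows "\<exists>Tstar::real. Tstar > 0 \<and> T = ereal Tstar \<and> solves_system {0..<Tstar} a b c \<and>
           filterlim (\<lambda>t. a t \<bullet> (b t *v c t)) at_top (at_left Tstar)"
proof -
  define S where "S = forward_interval T"
  have T: "0 < T" and sol: "solves_system S a b c"
    using assms(1) by (auto simp: maximal_forward_solution_def S_def)
  have S0: "0 \<in> S" using T by (simp add: S_def forward_interval_def zero_ereal_def)
  have S_cases: "S = (if T = \<infinity> then {0..} else {0..<real_of_ereal T})"
    using T by (cases T) (auto simp: S_def forward_interval_def)
  then have S: "convex S" by simp
  define x E D where "x t = a t \<bullet> a t" and "E t = a t \<bullet> (b t *v c t)"
    and "D t = (b t *v c t) \<bullet> (b t *v c t)
      + (transpose (b t) *v a t) \<bullet> (transpose (b t) *v a t) + (a t \<bullet> a t) * (c t \<bullet> c t)" for t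
  have x': "(x has_real_derivative 2 * E t) (at t within S)" if "t \<in> S" for t
    unfolding x_def E_def by (rule norm_a_deriv[OF sol that])
  have E': "(E has_real_derivative D t) (at t within S)" if "t \<in> S" for t
    unfolding E_def D_def by (rule E_deriv[OF sol that])
  define k where "k = a 0 \<bullet> a 0 - c 0 \<bullet> c 0"
  have y: "c t \<bullet> c t = x t - k" if "t \<in> S" for t
    using norm_difference_const(1)[OF sol S S0 that] by (simp add: x_def k_def)
  \<comment> \<open>The minimum merges the two cases of the hypothesis: it is |c(0)|^2 when |a(0)|
    is larger and |a(0)|^2 when it is smaller.\<close>
  define G where "G = (b 0 *v c 0) \<bullet> (b 0 *v c 0)
    - (transpose (b 0) *v a 0) \<bullet> (transpose (b 0) *v a 0)
    + (a 0 \<bullet> a 0 - c 0 \<bullet> c 0) * min (a 0 \<bullet> a 0) (c 0 \<bullet> c 0)"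
  have "G \<noteq> 0"
  proof (cases "norm (a 0) > norm (c 0)")
    case True
    then have "min (a 0 \<bullet> a 0) (c 0 \<bullet> c 0) = c 0 \<bullet> c 0"
      by (simp add: norm_le[symmetric])
    then show ?thesis using assms(3)[OF True]
      by (simp add: G_def power2_norm_eq_inner algebra_simps del: transpose_matrix_vector)
  next
    case False
    then have less: "norm (a 0) < norm (c 0)" using assms(2) by simp
    then have "min (a 0 \<bullet> a 0) (c 0 \<bullet> c 0) = a 0 \<bullet> a 0"
      by (simp add: norm_le[symmetric])
    then show ?thesis using assms(4)[OF less]
      by (simp add: G_def power2_norm_eq_inner algebra_simps del: transpose_matrix_vector)
  qed
  then have G: "\<bar>G\<bar> > 0" by simp
  have D_ge: "D t \<ge> \<bar>G\<bar>" if "t \<in> S" for t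
    unfolding D_def G_def by (rule E_deriv_lower_bound[OF sol S S0 that])
  have "T \<noteq> \<infinity>"
  proof
    assume "T = \<infinity>"
    then have S_eq: "S = {0..}" by (auto simp: S_def forward_interval_def)
    \<comment> \<open>Only the term |a|^2 |c|^2 of \<open>D\<close> is kept; the other two are
      squares.\<close>
    have "D t \<ge> x t * (x t - k)" if "t \<ge> 0" for t
      using y[of t] that by (simp add: D_def S_eq x_def del: transpose_matrix_vector)
    from no_global_solution[of x E D, OF _ _ G _ this] x' E' D_ge show False
      unfolding S_eq by simp
  qed
  with T obtain Ts where Ts: "T = ereal Ts" "Ts > 0" by (cases T) auto
  have S_eq: "S = {0..<Ts}" by (auto simp: S_def forward_interval_def Ts)
  have "filterlim E at_top (at_left Ts)"
    unfolding filterlim_at_top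
  proof
    fix Z
    \<comment> \<open>One such time suffices, because \<open>D > 0\<close> makes \<open>E\<close>
      increasing from there on.\<close>
    have "\<exists>s\<in>S. E s \<ge> Z"
    proof (rule ccontr)
      assume "\<not> ?thesis"
      then have EZ: "E t \<le> \<bar>Z\<bar>" if "t \<in> S" for t using that by fastforce
      \<comment> \<open>Integrates x' = 2 E \<le> 2 \<bar>Z\<bar> over the whole lifetime
        \<open>Ts\<close>.\<close>
      define X where "X = x 0 + 2 * \<bar>Z\<bar> * Ts"
      have xX: "x t \<le> X" if t: "t \<in> S" for t
      proof -
        have "2 * \<bar>Z\<bar> * 0 - x 0 \<le> 2 * \<bar>Z\<bar> * t - x t"
          by (rule mono_of_derivative_within[where s = 0 and t = t and S = S
              and f = "\<lambda>t. 2 * \<bar>Z\<bar> * t - x t" and f' = "\<lambda>t. 2 * \<bar>Z\<bar> - 2 * E t"])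
            (use t EZ in \<open>auto intro!: derivative_eq_intros x'[unfolded S_eq] simp: S_eq\<close>)
        moreover have "2 * \<bar>Z\<bar> * t \<le> 2 * \<bar>Z\<bar> * Ts"
          using t by (intro mult_left_mono) (auto simp: S_eq)
        ultimately show ?thesis by (simp add: X_def)
      qed
      \<comment> \<open>|b|^2 and |c|^2 differ from \<open>x\<close> by constants of motion, so the
        bound on \<open>x\<close> controls all three components.\<close>
      have "norm (a t, b t, c t) \<le> sqrt X + (sqrt (X + (b 0 \<bullet> b 0 - x 0)) + sqrt (X - k))"
        if "t \<in> S" for t
      proof -
        have "norm (a t, b t, c t) \<le> norm (a t) + (norm (b t) + norm (c t))"
          by (rule order_trans[OF norm_Pair_le add_left_mono[OF norm_Pair_le]])
        also have "\<dots> \<le> sqrt X + (sqrt (X + (b 0 \<bullet> b 0 - x 0)) + sqrt (X - k))"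
          using xX[OF that] y[OF that] norm_difference_const(2)[OF sol S S0 that]
          by (intro add_mono) (simp_all add: norm_eq_sqrt_inner x_def)
        finally show ?thesis .
      qed
      then show False using maximal_imp_unbounded assms(1) unfolding Ts S_eq by blast
    qed
    then obtain s where s: "s \<in> S" "E s \<ge> Z" by blast
    have "Z \<le> E t" if "s < t" "t < Ts" for t
    proof -
      have "0 \<le> D u" if "u \<in> S" for u using D_ge[OF that] by linarith
      then have "E s \<le> E t"
        using that s by (intro mono_of_derivative_within[of s t S E D] E') (auto simp: S_eq)
      with s show ?thesis by simp
    qed
    then show "eventually (\<lambda>t. Z \<le> E t) (at_left Ts)"
      using s(1) by (auto simp: S_eq eventually_at_left_field)
  qed
  with Ts sol S_eq show ?thesis unfolding E_def by auto
qed

end
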